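(* Let $K\ge 2$ be an integer and let $\mathcal{X}=\{x_1,\ldots,x_N\}$ be a finite collection of positive real numbers sorted so that $x_1\le x_2\le\cdots\le x_N$. Run the following algorithm on $\mathcal{X}$: (1) Set $\mathcal{X}_1=\mathcal{X}$, $\mathcal{X}_k=\emptyset$ for $2\le k\le K$, and $\mathcal{K}=\{1,\ldots,K\}$; let $S_k=\sum_{x\in\mathcal{X}_k}x$ always denote the current set sums. (2) If $|\mathcal{K}|=1$, stop; otherwise continue. (3) Let $i\in\mathcal{K}$ be an index of a set with the largest sum among the sets indexed by $\mathcal{K}$. (4) Let $j$ be an index of a set with the smallest sum, $j\in\arg\min_{k} S_k$. (5) Let $\mathcal{X}_*=\{x\in\mathcal{X}_i:\ |(S_i-x)-(S_j+x)|<|S_i-S_j|\}$. (6) If $\mathcal{X}_*=\emptyset$, set $\mathcal{K}\leftarrow\mathcal{K}\setminus\{i\}$ and return to (2); otherwise let $x_*=\max\mathcal{X}_*$. (7) Move $x_*$ from $\mathcal{X}_i$ to $\mathcal{X}_j$, update the sums, and return to (2). Then the algorithm terminates, and the partition $\{\mathcal{X}_k\}_{k=1}^K$ it outputs is locally optimal.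
   Context: A $K$-way partition of $\mathcal{X}$ is a family $\{\mathcal{X}_k\}_{k=1}^K$ of pairwise disjoint subsets whose union is $\mathcal{X}$, with set sums $S_k=\sum_{x\in\mathcal{X}_k}x$. Such a partition is called locally optimal if no single element transfer can decrease the absolute difference between the sums of its former and latter sets, i.e. $|(S_i-x)-(S_j+x)|\ge|S_i-S_j|$ for all indices $i,j$ and all $x\in\mathcal{X}_i$. *)

theory Defs
  imports Complex_Main "HOL-Library.Disjoint_Sets"
begin

text \<open>
  The collection may contain equal numbers, so an element is represented by its index
  \<open>n \<in> {1..N}\<close>, its value being \<open>x n\<close>. A family of sets is a function \<open>X\<close> from set indices to
  sets of element indices; only its values on \<open>{1..K}\<close> are relevant.
\<close>

definition set_sum :: "(nat \<Rightarrow> real) \<Rightarrow> (nat \<Rightarrow> nat set) \<Rightarrow> nat \<Rightarrow> real" where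
  "set_sum x X k = (\<Sum>n\<in>X k. x n)"

definition is_partition :: "nat \<Rightarrow> nat \<Rightarrow> (nat \<Rightarrow> nat set) \<Rightarrow> bool" where
  "is_partition K N X \<longleftrightarrow> disjoint_family_on X {1..K} \<and> (\<Union>k\<in>{1..K}. X k) = {1..N}"

definition locally_optimal :: "nat \<Rightarrow> nat \<Rightarrow> (nat \<Rightarrow> real) \<Rightarrow> (nat \<Rightarrow> nat set) \<Rightarrow> bool" where
  "locally_optimal K N x X \<longleftrightarrow> is_partition K N X \<and>
     (\<forall>i\<in>{1..K}. \<forall>j\<in>{1..K}. \<forall>n\<in>X i.
        \<bar>(set_sum x X i - x n) - (set_sum x X j + x n)\<bar> \<ge> \<bar>set_sum x X i - set_sum x X j\<bar>)"

definition improving :: "(nat \<Rightarrow> real) \<Rightarrow> (nat \<Rightarrow> nat set) \<Rightarrow> nat \<Rightarrow> nat \<Rightarrow> nat set" where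
  "improving x X i j =
     {n \<in> X i. \<bar>(set_sum x X i - x n) - (set_sum x X j + x n)\<bar> < \<bar>set_sum x X i - set_sum x X j\<bar>}"

text \<open>
  A state consists of the set \<open>A\<close> of indices still under consideration and the current family.
  One step is one pass through the loop. It is a relation because ties in the choice of the
  largest set, the smallest set and the largest improving element may be broken arbitrarily.
  The smallest set is sought among all \<open>K\<close> sets, not only those indexed by \<open>A\<close>.
\<close>

type_synonym state = "nat set \<times> (nat \<Rightarrow> nat set)"

definition initial_state :: "nat \<Rightarrow> nat \<Rightarrow> state" where
  "initial_state K N = ({1..K}, \<lambda>k. if k = 1 then {1..N} else {})"

definition halted :: "state \<Rightarrow> bool" where
  "halted s \<longleftrightarrow> card (fst s) = 1"

inductive step :: "nat \<Rightarrow> (nat \<Rightarrow> real) \<Rightarrow> state \<Rightarrow> state \<Rightarrow> bool"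
  for K :: nat and x :: "nat \<Rightarrow> real"
where
  discard:
    "\<lbrakk> \<not> halted (A, X);
       is_arg_max (set_sum x X) (\<lambda>k. k \<in> A) i;
       is_arg_min (set_sum x X) (\<lambda>k. k \<in> {1..K}) j;
       improving x X i j = {} \<rbrakk>
     \<Longrightarrow> step K x (A, X) (A - {i}, X)"
| transfer:
    "\<lbrakk> \<not> halted (A, X);
       is_arg_max (set_sum x X) (\<lambda>k. k \<in> A) i;
       is_arg_min (set_sum x X) (\<lambda>k. k \<in> {1..K}) j;
       is_arg_max x (\<lambda>n. n \<in> improving x X i j) m \<rbrakk>
     \<Longrightarrow> step K x (A, X) (A, X(i := X i - {m}, j := insert m (X j)))"

definition reachable :: "nat \<Rightarrow> nat \<Rightarrow> (nat \<Rightarrow> real) \<Rightarrow> state \<Rightarrow> bool" where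
  "reachable K N x s \<longleftrightarrow> (step K x)\<^sup>*\<^sup>* (initial_state K N) s"

text \<open>
  Termination for every way of breaking ties: there is no infinite run, and no run gets stuck
  in a state that does not meet the stopping condition.
\<close>

definition terminates :: "nat \<Rightarrow> nat \<Rightarrow> (nat \<Rightarrow> real) \<Rightarrow> bool" where
  "terminates K N x \<longleftrightarrow>
     (\<nexists>run. run 0 = initial_state K N \<and> (\<forall>t::nat. step K x (run t) (run (Suc t)))) \<and>
     (\<forall>s. reachable K N x s \<and> \<not> halted s \<longrightarrow> (\<exists>s'. step K x s s'))"

definition is_output :: "nat \<Rightarrow> nat \<Rightarrow> (nat \<Rightarrow> real) \<Rightarrow> (nat \<Rightarrow> nat set) \<Rightarrow> bool" where
  "is_output K N x X \<longleftrightarrow> (\<exists>A. reachable K N x (A, X) \<and> halted (A, X))"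

end

theory Submission
  imports Defs
begin

text \<open>
  For positive \<open>x\<close>, moving \<open>x\<close> from set \<open>i\<close> to set \<open>j\<close> is improving iff \<open>x < S\<^sub>i - S\<^sub>j\<close>.
  Hence a transfer strictly decreases the sum of the squares of the set sums and never
  decreases the minimal sum. As there are finitely many partitions and discarded indices are
  never reinstated, the algorithm terminates. Every discarded set has a sum at least as large
  as the sums of all sets still under consideration, so transfers never touch a discarded set;
  and since the minimal sum does not decrease, a discarded set never acquires an improving
  element. At the end, the single remaining set has minimal sum, so it has none either.
\<close>

lemma ex_is_arg_max_if_finite:
  fixes f :: "'a \<Rightarrow> real"
  assumes "finite S" "S \<noteq> {}"
  shows "\<exists>m. is_arg_max f (\<lambda>x. x \<in> S) m"
  using ex_is_arg_min_if_finite[OF assms, of "\<lambda>x. - f x"]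
  by (auto simp: is_arg_min_def is_arg_max_def)

text \<open>Comparing squares, \<open>(d - 2 * y)\<^sup>2 - d\<^sup>2 = 4 * y * (y - d)\<close>,
  which for positive \<open>y\<close> is negative exactly when \<open>y < d\<close>.\<close>

lemma abs_diff_twice_less_iff:
  fixes d y :: real
  assumes "y > 0"
  shows "\<bar>d - 2 * y\<bar> < \<bar>d\<bar> \<longleftrightarrow> y < d"
  using assms by linarith

lemma improving_iff:
  assumes "x n > 0"
  shows "n \<in> improving x X i j \<longleftrightarrow> n \<in> X i \<and> x n < set_sum x X i - set_sum x X j"
proof -
  have "(set_sum x X i - x n) - (set_sum x X j + x n) = (set_sum x X i - set_sum x X j) - 2 * x n"
    by simp
  then show ?thesis
    unfolding improving_def using abs_diff_twice_less_iff[OF assms] by simp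
qed

lemma is_partition_subset:
  assumes "is_partition K N X" "k \<in> {1..K}"
  shows "X k \<subseteq> {1..N}"
  using assms unfolding is_partition_def by blast

lemma is_partition_transfer:
  assumes "is_partition K N X" "i \<in> {1..K}" "j \<in> {1..K}" "i \<noteq> j" "m \<in> X i"
  shows "is_partition K N (X(i := X i - {m}, j := insert m (X j)))"
proof -
  let ?Y = "X(i := X i - {m}, j := insert m (X j))"
  have disj: "X a \<inter> X b = {}" if "a \<in> {1..K}" "b \<in> {1..K}" "a \<noteq> b" for a b
    using assms(1) that unfolding is_partition_def disjoint_family_on_def by blast
  have "?Y a \<inter> ?Y b = {}" if "a \<in> {1..K}" "b \<in> {1..K}" "a \<noteq> b" for a b
    using disj[OF that] disj[of i a] disj[of i b] that assms(2-5) by auto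
  moreover have "(\<Union>k\<in>{1..K}. ?Y k) = (\<Union>k\<in>{1..K}. X k)"
  proof (intro equalityI subsetI)
    fix n assume "n \<in> (\<Union>k\<in>{1..K}. ?Y k)"
    then show "n \<in> (\<Union>k\<in>{1..K}. X k)"
      using assms(2,3,5) by (auto split: if_splits)
  next
    fix n assume "n \<in> (\<Union>k\<in>{1..K}. X k)"
    then obtain k where k: "k \<in> {1..K}" "n \<in> X k" by blast
    show "n \<in> (\<Union>k\<in>{1..K}. ?Y k)"
    proof (cases "n = m")
      case True
      then show ?thesis using assms(3) by (intro UN_I[of j]) auto
    next
      case False
      then show ?thesis using k by (intro UN_I[of k]) auto
    qed
  qed
  ultimately show ?thesis
    using assms(1) unfolding is_partition_def disjoint_family_on_def by simp
qed

text \<open>An equation between functions, so that it also rewrites \<open>sum_squares\<close> of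
  the new family into the shape of \<open>sum_squares_update_less\<close>.\<close>

lemma set_sum_transfer:
  assumes "is_partition K N X" "i \<in> {1..K}" "j \<in> {1..K}" "i \<noteq> j" "m \<in> X i"
  shows "set_sum x (X(i := X i - {m}, j := insert m (X j))) =
    (set_sum x X)(i := set_sum x X i - x m, j := set_sum x X j + x m)"
proof -
  have fin: "finite (X i)" "finite (X j)"
    using is_partition_subset[OF assms(1)] assms(2,3) finite_subset by blast+
  have "m \<notin> X j"
    using assms unfolding is_partition_def disjoint_family_on_def by blast
  then show ?thesis
    using fin assms(4,5) by (auto simp: fun_eq_iff set_sum_def sum_diff1)
qed

text \<open>Fixing \<open>X k = {}\<close> outside \<open>{1..K}\<close> leaves only finitely many
  families. The last conjunct is, for positive elements, the absence of improving elements in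
  discarded sets, required against every index \<open>l\<close> because the minimal set changes
  during a run.\<close>

definition invariant :: "nat \<Rightarrow> nat \<Rightarrow> (nat \<Rightarrow> real) \<Rightarrow> state \<Rightarrow> bool" where
  "invariant K N x s \<longleftrightarrow> (case s of (A, X) \<Rightarrow>
     A \<subseteq> {1..K} \<and> A \<noteq> {} \<and> is_partition K N X \<and> (\<forall>k. k \<notin> {1..K} \<longrightarrow> X k = {}) \<and>
     (\<forall>k\<in>{1..K} - A. \<forall>l\<in>A. set_sum x X l \<le> set_sum x X k) \<and>
     (\<forall>k\<in>{1..K} - A. \<forall>l\<in>{1..K}. \<forall>n\<in>X k. set_sum x X k - set_sum x X l \<le> x n))"

definition sum_squares :: "nat \<Rightarrow> (nat \<Rightarrow> real) \<Rightarrow> (nat \<Rightarrow> nat set) \<Rightarrow> real" where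
  "sum_squares K x X = (\<Sum>k\<in>{1..K}. (set_sum x X k)\<^sup>2)"

text \<open>A lexicographic comparison. Since \<open><\<close> on reals is not well-founded, it
  yields termination only together with the finiteness of the state space.\<close>

definition progress :: "nat \<Rightarrow> (nat \<Rightarrow> real) \<Rightarrow> state \<Rightarrow> state \<Rightarrow> bool" where
  "progress K x s s' \<longleftrightarrow> card (fst s') < card (fst s) \<or>
     card (fst s') = card (fst s) \<and> sum_squares K x (snd s') < sum_squares K x (snd s)"

lemma progress_trans:
  "progress K x s t \<Longrightarrow> progress K x t u \<Longrightarrow> progress K x s u"
  unfolding progress_def by auto

lemma finite_invariant: "finite {s. invariant K N x s}"
proof (rule finite_subset)
  let ?F = "{X. \<forall>k. (k \<in> {1..K} \<longrightarrow> X k \<in> Pow {1..N}) \<and> (k \<notin> {1..K} \<longrightarrow> X k = {})}"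
  show "{s. invariant K N x s} \<subseteq> Pow {1..K} \<times> ?F"
    using is_partition_subset by (fastforce simp: invariant_def)
  show "finite (Pow {1..K} \<times> ?F)"
    by (intro finite_cartesian_product finite_set_of_finite_funs) auto
qed

text \<open>Only the terms at \<open>i\<close> and \<open>j\<close> change, and the total changes by
  \<open>- 2 * y * (f i - f j - y)\<close>.\<close>

lemma sum_squares_update_less:
  fixes f :: "'a \<Rightarrow> real"
  assumes "finite S" "i \<in> S" "j \<in> S" "i \<noteq> j" "0 < y" "y < f i - f j"
  shows "(\<Sum>k\<in>S. ((f(i := f i - y, j := f j + y)) k)\<^sup>2) < (\<Sum>k\<in>S. (f k)\<^sup>2)"
proof -
  let ?g = "f(i := f i - y, j := f j + y)"
  have split: "(\<Sum>k\<in>S. (h k)\<^sup>2) = (h i)\<^sup>2 + ((h j)\<^sup>2 + (\<Sum>k\<in>S - {i} - {j}. (h k)\<^sup>2))" for h :: "'a \<Rightarrow> real"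
    using assms(1-4) by (simp add: sum.remove[of S i] sum.remove[of "S - {i}" j])
  have rest: "(\<Sum>k\<in>S - {i} - {j}. (?g k)\<^sup>2) = (\<Sum>k\<in>S - {i} - {j}. (f k)\<^sup>2)"
    by (intro sum.cong) auto
  have "y * (f i - f j - y) > 0" using assms by simp
  then have "(f i - y)\<^sup>2 + (f j + y)\<^sup>2 < (f i)\<^sup>2 + (f j)\<^sup>2"
    by (simp add: power2_eq_square algebra_simps)
  then show ?thesis
    unfolding split[of ?g] split[of f] rest using assms(4) by simp
qed

lemma invariant_initial_state:
  assumes "K \<ge> 2"
  shows "invariant K N x (initial_state K N)"
  using assms
  by (auto simp: invariant_def initial_state_def is_partition_def disjoint_family_on_def
      split: if_splits)

lemma invariant_step:
  assumes "step K x s s'" and inv: "invariant K N x s" and pos: "\<forall>n\<in>{1..N}. x n > 0"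
  shows "invariant K N x s' \<and> progress K x s s'"
  using assms(1)
proof cases
  case (discard A X i j)
  note I = inv[unfolded discard(1) invariant_def prod.case]
  have A: "A \<subseteq> {1..K}" "finite A" "i \<in> A" "card A \<noteq> 1"
    using I discard(3,4) finite_subset[of A "{1..K}"] by (simp_all add: halted_def is_arg_max_def)
  have "A - {i} \<noteq> {}"
    using A by (metis card_1_singleton_iff insert_Diff One_nat_def)
  have min: "set_sum x X j \<le> set_sum x X l" if "l \<in> {1..K}" for l
    using discard(5) that by (auto simp: is_arg_min_def not_less)
  have max: "set_sum x X l \<le> set_sum x X i" if "l \<in> A" for l
    using discard(4) that by (auto simp: is_arg_max_def not_less)
  \<comment> \<open>The test of the algorithm concerns \<open>j\<close> only; minimality of the sum
    at \<open>j\<close> extends the bound to every \<open>l\<close>.\<close>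
  have elems: "set_sum x X i - set_sum x X l \<le> x n" if "l \<in> {1..K}" "n \<in> X i" for l n
  proof -
    have "n \<in> {1..N}" using is_partition_subset[of K N X i] I A that(2) by blast
    then have "\<not> x n < set_sum x X i - set_sum x X j"
      using improving_iff[of x n X i j] pos discard(6) that(2) by auto
    then show ?thesis using min[OF that(1)] by linarith
  qed
  have "invariant K N x (A - {i}, X)"
    unfolding invariant_def prod.case using I \<open>A - {i} \<noteq> {}\<close> max elems by blast
  moreover have "card (A - {i}) < card A" using A by (meson card_Diff1_less)
  ultimately show ?thesis using discard by (simp add: progress_def)
next
  case (transfer A X i j m)
  note I = inv[unfolded transfer(1) invariant_def prod.case]
  let ?S = "set_sum x X" and ?Y = "X(i := X i - {m}, j := insert m (X j))"
  have part: "is_partition K N X" and iA: "i \<in> A" and iK: "i \<in> {1..K}" and jK: "j \<in> {1..K}"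
    using I transfer(4,5) unfolding is_arg_max_def is_arg_min_def by blast+
  have imp: "m \<in> improving x X i j" using transfer(6) by (simp add: is_arg_max_def)
  then have mi: "m \<in> X i" by (simp add: improving_def)
  then have xm: "0 < x m" using is_partition_subset[OF part iK] pos by blast
  have gap: "x m < ?S i - ?S j" using imp improving_iff[of x m, OF xm] by blast
  have ij: "i \<noteq> j" using gap xm by auto
  \<comment> \<open>The index \<open>j\<close> is minimal among all \<open>K\<close> sets, so it
    might a priori be discarded; but discarded sums are at least the sum at \<open>i\<close>, while
    the gap is positive.\<close>
  have jA: "j \<in> A"
  proof (rule ccontr)
    assume "j \<notin> A"
    then have "?S i \<le> ?S j" using I iA jK by blast
    then show False using gap xm by linarith
  qed
  have min: "?S j \<le> ?S l" if "l \<in> {1..K}" for l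
    using transfer(5) that by (auto simp: is_arg_min_def not_less)
  have max: "?S l \<le> ?S i" if "l \<in> A" for l
    using transfer(4) that by (auto simp: is_arg_max_def not_less)
  note sums = set_sum_transfer[OF part iK jK ij mi, of x]
  have same: "set_sum x ?Y k = ?S k" "?Y k = X k" if "k \<notin> A" for k
    unfolding sums using that iA jA by auto
  \<comment> \<open>The receiving set stays below the old maximum, because
    \<open>?S j + x m < ?S i\<close>.\<close>
  have max': "set_sum x ?Y l \<le> ?S i" if "l \<in> A" for l
    unfolding sums using max[OF that] gap xm by auto
  \<comment> \<open>The giving set stays above the old minimum, because
    \<open>?S i - x m > ?S j\<close>.\<close>
  have min': "?S j \<le> set_sum x ?Y l" if "l \<in> {1..K}" for l
    unfolding sums using min[OF that] gap xm by auto
  have "set_sum x ?Y l \<le> set_sum x ?Y k" if "k \<in> {1..K} - A" "l \<in> A" for k l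
  proof -
    have "?S i \<le> ?S k" using I that iA by blast
    then show ?thesis using max'[OF that(2)] same(1)[of k] that by simp
  qed
  \<comment> \<open>The bound against the old minimum \<open>?S j\<close> suffices: set
    \<open>k\<close> is untouched and no new sum lies below \<open>?S j\<close>.\<close>
  moreover have "set_sum x ?Y k - set_sum x ?Y l \<le> x n"
    if "k \<in> {1..K} - A" "l \<in> {1..K}" "n \<in> ?Y k" for k l n
  proof -
    have "n \<in> X k" using that(1,3) same(2)[of k] by blast
    then have "?S k - ?S j \<le> x n" using I that(1) jK by blast
    then show ?thesis using min'[OF that(2)] same(1)[of k] that(1) by simp
  qed
  moreover have "?Y k = {}" if "k \<notin> {1..K}" for k
    using I that iK jK by auto
  ultimately have "invariant K N x (A, ?Y)"
    unfolding invariant_def prod.case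
    using I is_partition_transfer[OF part iK jK ij mi] by blast
  moreover have "sum_squares K x ?Y < sum_squares K x X"
    unfolding sum_squares_def sums
    by (rule sum_squares_update_less) (use iK jK ij xm gap in auto)
  ultimately show ?thesis using transfer by (simp add: progress_def)
qed

lemma invariant_reachable:
  assumes "reachable K N x s" "K \<ge> 2" "\<forall>n\<in>{1..N}. x n > 0"
  shows "invariant K N x s"
  using assms(1) unfolding reachable_def
proof induction
  case base
  show ?case using invariant_initial_state[OF assms(2)] .
next
  case (step s s')
  then show ?case using invariant_step assms(3) by blast
qed

text \<open>As \<open>progress\<close> is transitive and irreflexive, an infinite run would never
  repeat a state, yet it stays among the finitely many states satisfying the invariant.\<close>

lemma no_infinite_run:
  assumes "invariant K N x (run 0)" "\<forall>n\<in>{1..N}. x n > 0"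
    and steps: "\<forall>t::nat. step K x (run t) (run (Suc t))"
  shows False
proof -
  have inv: "invariant K N x (run t)" for t
  proof (induction t)
    case 0
    show ?case using assms(1) .
  next
    case (Suc t)
    show ?case using invariant_step[OF steps[rule_format] Suc assms(2)] by (rule conjunct1)
  qed
  have prog: "progress K x (run t) (run (Suc t))" for t
    using invariant_step[OF steps[rule_format] inv assms(2)] by (rule conjunct2)
  have "progress K x (run t) (run (t + Suc d))" for t d
  proof (induction d)
    case 0
    show ?case using prog by simp
  next
    case (Suc d)
    show ?case using progress_trans[OF Suc prog[of "t + Suc d"]] by simp
  qed
  then have less: "progress K x (run t) (run u)" if "t < u" for t u
    using less_imp_Suc_add[OF that] by (metis add_Suc_right)
  have "run t \<noteq> run u" if "t < u" for t u
    using less[OF that] by (auto simp: progress_def)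
  then have "inj run" by (metis injI linorder_neqE_nat)
  moreover have "finite (range run)"
    using inv by (intro finite_subset[OF _ finite_invariant[of K N x]]) auto
  ultimately show False using finite_imageD by blast
qed

lemma step_exists:
  assumes "invariant K N x s" "\<not> halted s"
  shows "\<exists>s'. step K x s s'"
proof -
  obtain A X where s: "s = (A, X)" by (cases s)
  have A: "A \<subseteq> {1..K}" "A \<noteq> {}" "is_partition K N X"
    using assms(1) s by (auto simp: invariant_def)
  then have "finite A" "{1..K} \<noteq> {}" using finite_subset by blast+
  then obtain i j where i: "is_arg_max (set_sum x X) (\<lambda>k. k \<in> A) i"
    and j: "is_arg_min (set_sum x X) (\<lambda>k. k \<in> {1..K}) j"
    using ex_is_arg_max_if_finite[OF _ A(2)] ex_is_arg_min_if_finite by (metis finite_atLeastAtMost)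
  have "i \<in> {1..K}" using i A by (auto simp: is_arg_max_def)
  then have "finite (X i)" using is_partition_subset[OF A(3)] finite_subset by blast
  then have "finite (improving x X i j)" by (simp add: improving_def)
  \<comment> \<open>Either no element is improving and \<open>discard\<close> applies, or a largest
    improving element exists and \<open>transfer\<close> applies.\<close>
  then show ?thesis
    using ex_is_arg_max_if_finite[of "improving x X i j" x]
      step.discard[OF _ i j] step.transfer[OF _ i j] assms(2) s by blast
qed

lemma locally_optimal_if_halted:
  assumes inv: "invariant K N x (A, X)" and "halted (A, X)" and pos: "\<forall>n\<in>{1..N}. x n > 0"
  shows "locally_optimal K N x X"
proof -
  note I = inv[unfolded invariant_def prod.case]
  obtain a where a: "A = {a}"
    using assms(2) by (auto simp: halted_def card_1_singleton_iff)
  have "n \<notin> improving x X i j" if ij: "i \<in> {1..K}" "j \<in> {1..K}" and n: "n \<in> X i" for i j n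
  proof -
    have xn: "x n > 0" using is_partition_subset[of K N X i] I ij n pos by blast
    have "set_sum x X i - set_sum x X j \<le> x n"
    proof (cases "i = a")
      case True
      \<comment> \<open>All indices other than \<open>a\<close> have been discarded, so their sums
        are at least that of \<open>a\<close>; the difference is therefore nonpositive.\<close>
      then have "set_sum x X i \<le> set_sum x X j"
        using I a ij by (cases "j = a") auto
      then show ?thesis using xn by linarith
    next
      case False
      then show ?thesis using I a ij n by blast
    qed
    then show ?thesis using improving_iff[of x n, OF xn] by fastforce
  qed
  then show ?thesis
    using I unfolding locally_optimal_def improving_def by (auto simp: not_less)
qed

theorem theorem1:
  fixes K N :: nat and x :: "nat \<Rightarrow> real"
  assumes "K \<ge> 2"
    and "\<forall>n\<in>{1..N}. x n > 0"
    and "mono_on {1..N} x"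
  shows "terminates K N x \<and> (\<forall>X. is_output K N x X \<longrightarrow> locally_optimal K N x X)"
proof
  show "terminates K N x"
    unfolding terminates_def
    using no_infinite_run[OF _ assms(2)] invariant_initial_state[OF assms(1)]
      step_exists invariant_reachable[OF _ assms(1,2)] by metis
  show "\<forall>X. is_output K N x X \<longrightarrow> locally_optimal K N x X"
    unfolding is_output_def
    using locally_optimal_if_halted invariant_reachable assms(1,2) by blast
qed

end
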